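(* Let $q\in(0,1]$, let $\beta=\{\beta_n\}_{n=0}^\infty$ be a bounded sequence of purely imaginary numbers, and let $T_\beta$ be the weighted shift operator on $A^2(\mathbb{D})$ defined by $T_\beta\left(\sum_{n=0}^\infty a_nz^n\right)=\sum_{n=0}^\infty a_n\beta_nz^{n+1}$. Then $\mathbf{Ber}_q(T_\beta)$ is symmetric with respect to the imaginary axis.
   Context: $\mathbb{D}$ is the open unit disk; $A^2(\mathbb{D})$ is the Bergman space of holomorphic $f$ on $\mathbb{D}$ with $\int_{\mathbb{D}}|f|^2dA<\infty$, $dA$ being area measure normalized so that $\mathbb{D}$ has area $1$. Its normalized reproducing kernel is $\hat k_\lambda(z)=\frac{1-|\lambda|^2}{(1-\overline\lambda z)^2}$, $\lambda,z\in\mathbb{D}$. For a bounded operator $T$ on $A^2(\mathbb{D})$, $\mathbf{Ber}_q(T)=\{\langle T\hat k_\lambda,\hat k_\mu\rangle:\lambda,\mu\in\mathbb{D},\ \langle\hat k_\lambda,\hat k_\mu\rangle=q\}$. *)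

theory Defs
  imports "HOL-Complex_Analysis.Complex_Analysis"
begin

abbreviation unit_disk :: "complex set" where
  "unit_disk \<equiv> ball 0 1"

text \<open>
  An element of the Bergman space is represented by any total function extending it; all
  notions below depend only on its restriction to the unit disk. The integrals are divided
  by \<open>pi\<close> because the area measure is normalized so that the unit disk has area 1.
\<close>

definition bergman_space :: "(complex \<Rightarrow> complex) set" where
  "bergman_space =
     {f. f holomorphic_on unit_disk \<and> set_integrable lborel unit_disk (\<lambda>z. (cmod (f z))\<^sup>2)}"

definition bergman_inner :: "(complex \<Rightarrow> complex) \<Rightarrow> (complex \<Rightarrow> complex) \<Rightarrow> complex" where
  "bergman_inner f g = (LINT z:unit_disk|lborel. f z * cnj (g z)) / of_real pi"

definition normalized_kernel :: "complex \<Rightarrow> complex \<Rightarrow> complex" where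
  "normalized_kernel w z = of_real (1 - (cmod w)\<^sup>2) / (1 - cnj w * z)\<^sup>2"

definition berezin_range ::
  "complex \<Rightarrow> ((complex \<Rightarrow> complex) \<Rightarrow> (complex \<Rightarrow> complex)) \<Rightarrow> complex set" where
  "berezin_range q T =
     {bergman_inner (T (normalized_kernel w)) (normalized_kernel w') | w w'.
        w \<in> unit_disk \<and> w' \<in> unit_disk \<and>
        bergman_inner (normalized_kernel w) (normalized_kernel w') = q}"

definition taylor_coeff :: "(complex \<Rightarrow> complex) \<Rightarrow> nat \<Rightarrow> complex" where
  "taylor_coeff f n = (deriv ^^ n) f 0 / fact n"

text \<open>The weighted shift has domain \<^const>\<open>bergman_space\<close>; it is left undefined elsewhere.\<close>

definition weighted_shift ::
  "(nat \<Rightarrow> complex) \<Rightarrow> (complex \<Rightarrow> complex) \<Rightarrow> (complex \<Rightarrow> complex)" where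
  "weighted_shift \<beta> =
     (\<lambda>f\<in>bergman_space. \<lambda>z. \<Sum>n. taylor_coeff f n * \<beta> n * z ^ Suc n)"

definition symmetric_about_imaginary_axis :: "complex set \<Rightarrow> bool" where
  "symmetric_about_imaginary_axis S \<longleftrightarrow> (\<lambda>w. - cnj w) ` S = S"

end

theory Submission imports Defs
begin

text \<open>
  The antiunitary involution \<open>C f = cnj \<circ> f \<circ> cnj\<close> of the Bergman space satisfies
  \<open>\<langle>C f, C g\<rangle> = cnj \<langle>f, g\<rangle>\<close>, and sends the normalized kernel at \<open>w\<close> to the one at \<open>cnj w\<close>.
  As the weights are imaginary, \<open>C\<close> anticommutes with the shift. Hence replacing the pair
  \<open>(w, w')\<close> by \<open>(cnj w, cnj w')\<close> turns \<open>\<langle>T k\<^sub>w, k\<^sub>w\<^sub>'\<rangle>\<close> into minus its conjugate, while the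
  constraint is preserved because \<open>q\<close> is real.
\<close>

text \<open>Conjugation is diagonal in the real basis 1, i, with factors 1 and -1, so its Jacobian
  has absolute value 1.\<close>

lemma lborel_distr_cnj: "distr lborel lborel cnj = (lborel :: complex measure)"
proof -
  define c :: "complex \<Rightarrow> real" where "c j = (if j = 1 then 1 else -1)" for j
  have T: "(\<lambda>x. 0 + (\<Sum>j\<in>Basis. (c j * (x \<bullet> j)) *\<^sub>R j)) = cnj"
    by (auto simp: fun_eq_iff Basis_complex_def c_def complex_eq_iff)
  have "lborel = density (distr lborel borel cnj) (\<lambda>_. ennreal (\<Prod>j\<in>Basis. \<bar>c j\<bar>))"
    using lborel_affine_euclidean[of c 0] unfolding T by (simp add: c_def)
  also have "(\<Prod>j\<in>Basis. \<bar>c j\<bar>) = 1"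
    by (simp add: c_def Basis_complex_def)
  finally have "lborel = distr lborel borel cnj"
    by (simp add: density_1)
  \<comment> \<open>\<open>distr\<close> uses only the sets of its target measure, so
    \<open>borel\<close> may be replaced by \<open>lborel\<close>.\<close>
  then show ?thesis
    by (metis distr_cong sets_lborel)
qed

lemma cnj_measurable [measurable]: "cnj \<in> borel_measurable borel"
  by (intro borel_measurable_continuous_onI continuous_intros)

lemma integrable_lborel_cnj:
  fixes f :: "complex \<Rightarrow> 'b::{banach, second_countable_topology}"
  assumes "integrable lborel f"
  shows "integrable lborel (\<lambda>z. f (cnj z))"
proof -
  have "integrable (distr lborel lborel cnj) f"
    using assms by (simp add: lborel_distr_cnj)
  then show ?thesis
    by (rule integrable_distr[rotated]) simp
qed

lemma integral_lborel_cnj: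
  fixes f :: "complex \<Rightarrow> 'b::{banach, second_countable_topology}"
  shows "(LINT z|lborel. f (cnj z)) = integral\<^sup>L lborel f"
proof (cases "integrable lborel f")
  case True
  have "integral\<^sup>L (distr lborel lborel cnj) f = (LINT z|lborel. f (cnj z))"
    by (rule integral_distr) (use True in auto)
  then show ?thesis
    by (simp add: lborel_distr_cnj)
next
  case False
  \<comment> \<open>As \<open>cnj\<close> is an involution, integrability of the reflected function
    would give that of \<open>f\<close>. So both integrals take the default value 0.\<close>
  then have "\<not> integrable lborel (\<lambda>z. f (cnj z))"
    using integrable_lborel_cnj[of "\<lambda>z. f (cnj z)"] by auto
  with False show ?thesis
    by (simp add: not_integrable_integral_eq)
qed

text \<open>The anticommutation with the shift is established only on the disk, where the series
  converge; this lets it be used inside inner products.\<close>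

lemma bergman_inner_cong:
  assumes "\<And>z. z \<in> unit_disk \<Longrightarrow> f z = f' z" "\<And>z. z \<in> unit_disk \<Longrightarrow> g z = g' z"
  shows "bergman_inner f g = bergman_inner f' g'"
  unfolding bergman_inner_def set_lebesgue_integral_def
  by (auto intro!: arg_cong2[where f = "(/)"] Bochner_Integration.integral_cong
        simp: assms indicator_def simp del: mem_ball)

text \<open>The substitution of \<open>cnj z\<close> for \<open>z\<close> preserves both area and
  the disk, and conjugation commutes with the integral.\<close>

lemma bergman_inner_cnj:
  "bergman_inner (cnj \<circ> f \<circ> cnj) (cnj \<circ> g \<circ> cnj) = cnj (bergman_inner f g)"
proof -
  have "(LINT z:unit_disk|lborel. (cnj \<circ> f \<circ> cnj) z * cnj ((cnj \<circ> g \<circ> cnj) z)) =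
        (LINT z|lborel. cnj (indicator unit_disk (cnj z) *\<^sub>R (f (cnj z) * cnj (g (cnj z)))))"
    unfolding set_lebesgue_integral_def
    by (intro Bochner_Integration.integral_cong) (auto simp: indicator_def)
  also have "\<dots> = cnj (LINT z|lborel. indicator unit_disk z *\<^sub>R (f z * cnj (g z)))"
    by (simp only: Bochner_Integration.integral_cnj
        integral_lborel_cnj[of "\<lambda>z. indicator unit_disk z *\<^sub>R (f z * cnj (g z))"])
  finally show ?thesis
    by (simp add: bergman_inner_def set_lebesgue_integral_def)
qed

lemma bergman_inner_minus_left: "bergman_inner (\<lambda>z. - f z) g = - bergman_inner f g"
  by (simp add: bergman_inner_def set_lebesgue_integral_def)

lemma holomorphic_on_disk_cnj:
  assumes "f holomorphic_on unit_disk"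
  shows "(cnj \<circ> f \<circ> cnj) holomorphic_on unit_disk"
proof -
  have "\<exists>D. ((cnj \<circ> f \<circ> cnj) has_field_derivative D) (at z)" if "z \<in> unit_disk" for z
  proof -
    have "(f has_field_derivative deriv f (cnj z)) (at (cnj z))"
      using assms that by (intro holomorphic_derivI[of _ unit_disk]) auto
    then show ?thesis
      using has_field_derivative_cnj_cnj by blast
  qed
  then show ?thesis
    by (simp add: holomorphic_on_open)
qed

lemma bergman_space_cnj:
  assumes "f \<in> bergman_space"
  shows "cnj \<circ> f \<circ> cnj \<in> bergman_space"
proof -
  have "integrable lborel (\<lambda>z. indicator unit_disk z *\<^sub>R (cmod (f z))\<^sup>2)"
    using assms by (simp add: bergman_space_def set_integrable_def)
  from integrable_lborel_cnj[OF this]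
  have "set_integrable lborel unit_disk (\<lambda>z. (cmod ((cnj \<circ> f \<circ> cnj) z))\<^sup>2)"
    by (simp add: set_integrable_def indicator_def)
  with assms show ?thesis
    by (simp add: bergman_space_def holomorphic_on_disk_cnj)
qed

text \<open>Taylor coefficients need this only at 0, but the induction needs all of the disk:
  differentiating once more uses the identity on a neighbourhood of \<open>z\<close>.\<close>

lemma higher_deriv_cnj:
  assumes "f holomorphic_on unit_disk" "z \<in> unit_disk"
  shows "(deriv ^^ n) (cnj \<circ> f \<circ> cnj) z = cnj ((deriv ^^ n) f (cnj z))"
  using assms(2)
proof (induction n arbitrary: z)
  case 0
  then show ?case by simp
next
  case (Suc n)
  have "((deriv ^^ n) f has_field_derivative deriv ((deriv ^^ n) f) (cnj z)) (at (cnj z))"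
    using Suc.prems
    by (intro holomorphic_derivI[of _ unit_disk] holomorphic_higher_deriv assms) auto
  then have "((cnj \<circ> (deriv ^^ n) f \<circ> cnj) has_field_derivative
      cnj (deriv ((deriv ^^ n) f) (cnj z))) (at z)"
    by (rule has_field_derivative_cnj_cnj)
  moreover have "eventually (\<lambda>u. u \<in> unit_disk) (nhds z)"
    using Suc.prems by (intro eventually_nhds_in_open) auto
  then have "eventually (\<lambda>u. (deriv ^^ n) (cnj \<circ> f \<circ> cnj) u = (cnj \<circ> (deriv ^^ n) f \<circ> cnj) u) (nhds z)"
    by eventually_elim (simp add: Suc.IH)
  then have "deriv ((deriv ^^ n) (cnj \<circ> f \<circ> cnj)) z = deriv (cnj \<circ> (deriv ^^ n) f \<circ> cnj) z"
    by (rule deriv_cong_ev) simp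
  ultimately show ?case
    by (metis DERIV_imp_deriv comp_apply funpow.simps(2))
qed

lemma taylor_coeff_cnj:
  assumes "f holomorphic_on unit_disk"
  shows "taylor_coeff (cnj \<circ> f \<circ> cnj) n = cnj (taylor_coeff f n)"
  using higher_deriv_cnj[OF assms, of 0 n] by (simp add: taylor_coeff_def)

text \<open>Bounded weights and one extra factor \<open>z\<close> change the terms of the absolutely
  convergent Taylor series by a bounded factor. Convergence is what allows conjugation to pass
  through the infinite sum later.\<close>

lemma summable_weighted_shift:
  assumes "f holomorphic_on unit_disk" "bounded (range \<beta>)" "z \<in> unit_disk"
  shows "summable (\<lambda>n. taylor_coeff f n * \<beta> n * z ^ Suc n)"
proof -
  obtain B where B: "cmod (\<beta> n) \<le> B" for n
    using assms(2) by (auto simp: bounded_iff)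
  \<comment> \<open>Convergence of the Taylor series at a radius strictly beyond
    \<open>cmod z\<close> gives absolute convergence at \<open>z\<close>.\<close>
  obtain r where r: "cmod z < r" "r < 1"
    using assms(3) dense by auto
  then have "0 < r" by (meson norm_ge_zero le_less_trans)
  then have "(\<lambda>n. taylor_coeff f n * of_real r ^ n) sums f (of_real r)"
    using holomorphic_power_series[OF assms(1), of "of_real r"] r
    by (simp add: taylor_coeff_def)
  then have "summable (\<lambda>n. norm (taylor_coeff f n * z ^ n))"
    using r \<open>0 < r\<close> by (intro powser_insidea[of _ "of_real r"]) (auto dest: sums_summable)
  then have "summable (\<lambda>n. norm (taylor_coeff f n * z ^ n) * (B * cmod z))"
    by (rule summable_mult2)
  moreover have "norm (taylor_coeff f n * \<beta> n * z ^ Suc n) \<le>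
      norm (taylor_coeff f n * z ^ n) * (B * cmod z)" for n
  proof -
    have "norm (taylor_coeff f n * z ^ n) * (cmod (\<beta> n) * cmod z) \<le>
        norm (taylor_coeff f n * z ^ n) * (B * cmod z)"
      by (intro mult_left_mono mult_right_mono B) auto
    then show ?thesis
      by (simp add: norm_mult mult_ac)
  qed
  ultimately show ?thesis
    by (rule summable_comparison_test'[where N = 0])
qed

text \<open>Termwise, \<open>cnj\<close> acts on the Taylor coefficient, the weight and the power
  separately; the minus sign comes from the imaginary weight.\<close>

lemma weighted_shift_cnj:
  assumes f: "f \<in> bergman_space" and \<beta>: "bounded (range \<beta>)" "\<And>n. Re (\<beta> n) = 0"
    and z: "z \<in> unit_disk"
  shows "weighted_shift \<beta> (cnj \<circ> f \<circ> cnj) z = - (cnj \<circ> weighted_shift \<beta> f \<circ> cnj) z"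
proof -
  have hol: "f holomorphic_on unit_disk"
    using f by (simp add: bergman_space_def)
  have [simp]: "cnj (\<beta> n) = - \<beta> n" for n
    using \<beta>(2)[of n] by (simp add: complex_eq_iff)
  have "(\<lambda>n. taylor_coeff f n * \<beta> n * cnj z ^ Suc n) sums
      (\<Sum>n. taylor_coeff f n * \<beta> n * cnj z ^ Suc n)"
    using summable_weighted_shift[OF hol \<beta>(1), of "cnj z"] z by (simp add: summable_sums)
  then have "(\<lambda>n. - cnj (taylor_coeff f n * \<beta> n * cnj z ^ Suc n)) sums
      (- cnj (\<Sum>n. taylor_coeff f n * \<beta> n * cnj z ^ Suc n))"
    by (intro sums_minus) (simp only: sums_cnj)
  then have "(\<Sum>n. taylor_coeff (cnj \<circ> f \<circ> cnj) n * \<beta> n * z ^ Suc n) =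
      - cnj (\<Sum>n. taylor_coeff f n * \<beta> n * cnj z ^ Suc n)"
    by (intro sums_unique[symmetric]) (simp add: taylor_coeff_cnj[OF hol])
  then show ?thesis
    using f by (simp add: weighted_shift_def bergman_space_cnj)
qed

lemma normalized_kernel_cnj: "normalized_kernel (cnj w) = cnj \<circ> normalized_kernel w \<circ> cnj"
  by (simp add: fun_eq_iff normalized_kernel_def)

text \<open>The shift is specified only on \<open>bergman_space\<close>, so the kernels have to be
  placed in its domain before it can be evaluated on them.\<close>

lemma normalized_kernel_in_bergman_space:
  assumes "w \<in> unit_disk"
  shows "normalized_kernel w \<in> bergman_space"
proof -
  \<comment> \<open>The denominator is controlled on the closed disk so that square integrability
    follows from continuity on a compact set.\<close>
  have nz: "1 - cnj w * z \<noteq> 0" if "z \<in> cball 0 1" for z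
  proof -
    have "cmod (cnj w * z) \<le> cmod w * 1"
      using that unfolding norm_mult by (intro mult_mono) auto
    also have "\<dots> < 1"
      using assms by simp
    finally show ?thesis
      by auto
  qed
  have "normalized_kernel w holomorphic_on unit_disk"
    unfolding normalized_kernel_def using nz by (intro holomorphic_intros) auto
  moreover have "continuous_on (cball 0 1) (\<lambda>z. (cmod (normalized_kernel w z))\<^sup>2)"
    unfolding normalized_kernel_def using nz by (intro continuous_intros) auto
  then have "set_integrable lborel (cball 0 1) (\<lambda>z. (cmod (normalized_kernel w z))\<^sup>2)"
    unfolding set_integrable_def by (intro borel_integrable_compact) auto
  then have "set_integrable lborel unit_disk (\<lambda>z. (cmod (normalized_kernel w z))\<^sup>2)"
    by (rule set_integrable_subset) auto
  ultimately show ?thesis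
    by (simp add: bergman_space_def)
qed

lemma berezin_range_minus_cnj:
  fixes q :: real
  assumes \<beta>: "bounded (range \<beta>)" "\<And>n. Re (\<beta> n) = 0"
    and x: "x \<in> berezin_range (of_real q) (weighted_shift \<beta>)"
  shows "- cnj x \<in> berezin_range (of_real q) (weighted_shift \<beta>)"
proof -
  let ?T = "weighted_shift \<beta>" and ?k = normalized_kernel
  obtain w w' where w: "w \<in> unit_disk" and w': "w' \<in> unit_disk"
    and q: "bergman_inner (?k w) (?k w') = of_real q"
    and x: "x = bergman_inner (?T (?k w)) (?k w')"
    using x by (auto simp: berezin_range_def)
  have "bergman_inner (?T (?k (cnj w))) (?k (cnj w')) =
      bergman_inner (\<lambda>z. - (cnj \<circ> ?T (?k w) \<circ> cnj) z) (cnj \<circ> ?k w' \<circ> cnj)"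
    unfolding normalized_kernel_cnj using w
    by (intro bergman_inner_cong weighted_shift_cnj \<beta> normalized_kernel_in_bergman_space refl)
  also have "\<dots> = - cnj x"
    by (simp only: bergman_inner_minus_left bergman_inner_cnj x)
  finally have "- cnj x = bergman_inner (?T (?k (cnj w))) (?k (cnj w'))"
    by simp
  moreover have "bergman_inner (?k (cnj w)) (?k (cnj w')) = of_real q"
    by (simp only: normalized_kernel_cnj bergman_inner_cnj q complex_cnj_complex_of_real)
  moreover have "cnj w \<in> unit_disk" "cnj w' \<in> unit_disk"
    using w w' by auto
  ultimately show ?thesis
    unfolding berezin_range_def by blast
qed

theorem theorem3p12:
  fixes q :: real and \<beta> :: "nat \<Rightarrow> complex"
  assumes "0 < q" and "q \<le> 1"
    and "bounded (range \<beta>)"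
    and "\<And>n. Re (\<beta> n) = 0"
  shows "symmetric_about_imaginary_axis (berezin_range (of_real q) (weighted_shift \<beta>))"
  unfolding symmetric_about_imaginary_axis_def
proof (intro equalityI subsetI)
  let ?S = "berezin_range (of_real q) (weighted_shift \<beta>)"
  note minus_cnj = berezin_range_minus_cnj[OF assms(3,4), of _ q]
  show "x \<in> ?S" if "x \<in> (\<lambda>w. - cnj w) ` ?S" for x
    using that minus_cnj by auto
  \<comment> \<open>The reflection is an involution, so \<open>x\<close> is the image of its own
    reflection, which lies in \<open>?S\<close> by the invariance just used.\<close>
  show "x \<in> (\<lambda>w. - cnj w) ` ?S" if "x \<in> ?S" for x
    using minus_cnj[OF that] by (intro image_eqI[of _ _ "- cnj x"]) auto
qed

end
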